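(* Let $G$ be a finite simple graph with no isolated vertices, with $n$ vertices, $m$ edges and vertex degrees $d_1,\dots,d_n$, and let $\lambda$ be the largest eigenvalue of the adjacency matrix of $G$. Let $R_\alpha=\sum_{ij\in E(G)}(d_id_j)^\alpha$ and $Q_\alpha=\sum_{i\in V(G)}d_i^\alpha$. Then: (i) for $\alpha<0$, $R_\alpha\ge m\lambda^{2\alpha}$; (ii) for $0<\alpha\le 0.5$, $R_\alpha\le m\lambda^{2\alpha}$; (iii) for $\alpha<0$, $Q_\alpha\ge n\lambda^{\alpha}$; (iv) for $0<\alpha\le 1$, $Q_\alpha\le n\lambda^{\alpha}$.
   Context: $R_\alpha$ is the general Randić index and $Q_\alpha$ the zeroth-order general Randić index; the sum in $R_\alpha$ runs over all edges $ij$ of $G$, with $d_i$ the degree of vertex $i$. *)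

theory Defs
  imports "Jordan_Normal_Form.Spectral_Radius"
begin

definition simple_graph :: "'a set \<Rightarrow> 'a set set \<Rightarrow> bool" where
  "simple_graph V E \<longleftrightarrow> finite V \<and> (\<forall>e\<in>E. e \<subseteq> V \<and> card e = 2)"

definition vdegree :: "'a set set \<Rightarrow> 'a \<Rightarrow> nat" where
  "vdegree E v = card {e \<in> E. v \<in> e}"

definition no_isolated_vertices :: "'a set \<Rightarrow> 'a set set \<Rightarrow> bool" where
  "no_isolated_vertices V E \<longleftrightarrow> (\<forall>v\<in>V. vdegree E v \<noteq> 0)"

(* The list vs enumerates the vertices without repetition; row and column i belong to vs ! i.
   The diagonal vanishes because {v, v} is a singleton and hence not an edge. *)
definition adjacency_matrix :: "'a list \<Rightarrow> 'a set set \<Rightarrow> real mat" where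
  "adjacency_matrix vs E =
     mat (length vs) (length vs) (\<lambda>(i, j). if {vs ! i, vs ! j} \<in> E then 1 else 0)"

(* For a real matrix, spectrum contains the real eigenvalues only. This is used for symmetric
   matrices, which have no others. For the 0 by 0 matrix the value is unspecified. *)
definition largest_eigenvalue :: "real mat \<Rightarrow> real" where
  "largest_eigenvalue A = Max (spectrum A)"

(* Every edge e is a two-element set {i, j}, so the inner product is d_i * d_j. *)
definition randic_index :: "real \<Rightarrow> 'a set set \<Rightarrow> real" where
  "randic_index \<alpha> E = (\<Sum>e\<in>E. (\<Prod>v\<in>e. real (vdegree E v)) powr \<alpha>)"

definition zeroth_randic_index :: "real \<Rightarrow> 'a set \<Rightarrow> 'a set set \<Rightarrow> real" where
  "zeroth_randic_index \<alpha> V E = (\<Sum>v\<in>V. real (vdegree E v) powr \<alpha>)"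

end

theory Submission
  imports Defs "HOL-Analysis.Function_Topology" "HOL-Analysis.Convex"
begin

text \<open>By the Rayleigh principle, the largest eigenvalue is at least the mean of the degrees (test vector
  \<open>1\<close>) and at least the mean of \<open>sqrt (d\<^sub>i d\<^sub>j)\<close> over the edges (test vector
  \<open>sqrt d\<^sub>i\<close>). All four bounds are then instances of Jensen's inequality for a power function,
  in the form of its tangent line at the largest eigenvalue. The exponent for \<open>R\<^sub>\<alpha>\<close> is
  \<open>2 * \<alpha>\<close>, whence the restriction \<open>\<alpha> \<le> 1/2\<close>.\<close>

section \<open>Rayleigh quotients\<close>

text \<open>For small \<open>t\<close> the linear term dominates, so a nonzero \<open>b\<close>
  would give a negative value at some \<open>t\<close> of sign opposite to \<open>b\<close>. This is
  the first-order condition at a maximizer.\<close>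

lemma linear_coeff_zero_if_quadratic_nonneg:
  fixes b c :: real
  assumes "\<And>t. 0 \<le> t * b + t\<^sup>2 * c"
  shows "b = 0"
proof (rule ccontr)
  assume "b \<noteq> 0"
  \<comment> \<open>Any positive \<open>s\<close> exceeding \<open>c\<close> serves: at
    \<open>t = - b / s\<close> the quadratic equals \<open>(b / s)^2 * (c - s) < 0\<close>.\<close>
  define s where "s = \<bar>c\<bar> + 1"
  have s: "s > 0" "c < s" unfolding s_def by auto
  have "0 \<le> (- b / s) * b + (- b / s)\<^sup>2 * c" by (rule assms)
  also have "\<dots> = (b\<^sup>2 / s\<^sup>2) * (c - s)"
    using s by (simp add: field_simps power2_eq_square)
  also have "\<dots> < 0"
    using s \<open>b \<noteq> 0\<close> by (intro mult_pos_neg) auto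
  finally show False by simp
qed

text \<open>The quadratic form attains its maximum \<open>\<mu>\<close> on the compact unit sphere.
  Homogeneity extends the bound to all vectors, and vanishing of the first variation makes the
  maximizer \<open>u\<close> an eigenvector for \<open>\<mu>\<close>.\<close>

lemma symmetric_max_eigenvector:
  fixes a :: "'i \<Rightarrow> 'i \<Rightarrow> real"
  assumes fin: "finite I" and ne: "I \<noteq> {}"
    and sym: "\<And>i j. i \<in> I \<Longrightarrow> j \<in> I \<Longrightarrow> a i j = a j i"
  obtains \<mu> u where "\<exists>i\<in>I. u i \<noteq> 0"
    and "\<And>i. i \<in> I \<Longrightarrow> (\<Sum>j\<in>I. a i j * u j) = \<mu> * u i"
    and "\<And>x. (\<Sum>i\<in>I. \<Sum>j\<in>I. a i j * x i * x j) \<le> \<mu> * (\<Sum>i\<in>I. (x i)\<^sup>2)"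
proof -
  define Q where "Q x = (\<Sum>i\<in>I. \<Sum>j\<in>I. a i j * x i * x j)" for x :: "'i \<Rightarrow> real"
  define N where "N x = (\<Sum>i\<in>I. (x i)\<^sup>2)" for x :: "'i \<Rightarrow> real"
  \<comment> \<open>Vectors are functions on the whole type \<open>'i\<close>, so coordinates
    outside \<open>I\<close> are pinned to 0. The box is then compact by Tychonoff, and the unit
    sphere is a closed subset of it.\<close>
  define B :: "('i \<Rightarrow> real) set"
    where "B = PiE UNIV (\<lambda>i. if i \<in> I then {-1..1} else {0})"
  define K where "K = B \<inter> {x. N x = 1}"
  have "compactin (product_topology (\<lambda>_. euclidean) UNIV) B"
    unfolding B_def compactin_PiE by auto
  then have "compact B"
    by (simp add: euclidean_product_topology)
  moreover have contN: "continuous_on UNIV N"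
    unfolding N_def by (intro continuous_intros continuous_on_product_coordinates)
  then have "closed {x. N x = 1}"
    by (intro closed_Collect_eq continuous_on_const)
  ultimately have "compact K"
    unfolding K_def by (rule compact_Int_closed)
  obtain k where k: "k \<in> I" using ne by auto
  have "N (\<lambda>i. if i = k then 1 else 0) = 1"
    unfolding N_def using fin k by (simp add: if_distrib[of "\<lambda>x. x ^ 2"] cong: if_cong)
  then have "(\<lambda>i. if i = k then 1 else 0) \<in> K"
    unfolding K_def B_def using k by auto
  moreover have "continuous_on K Q"
    unfolding Q_def
    by (intro continuous_intros continuous_on_subset[OF continuous_on_product_coordinates]) auto
  ultimately obtain u where u: "u \<in> K" and umax: "\<And>x. x \<in> K \<Longrightarrow> Q x \<le> Q u"
    using continuous_attains_sup[OF \<open>compact K\<close>, of Q] by blast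
  define \<mu> where "\<mu> = Q u"
  have Nu: "N u = 1" using u unfolding K_def by auto
  \<comment> \<open>\<open>Q\<close> and \<open>N\<close> are homogeneous of degree 2 and see only
    coordinates in \<open>I\<close>. Hence a nonzero \<open>x\<close> may be scaled to norm 1 and
    cut off outside \<open>I\<close>, which puts it in \<open>K\<close>.\<close>
  have bound: "Q x \<le> \<mu> * N x" for x
  proof (cases "N x = 0")
    case True
    then have "\<forall>i\<in>I. x i = 0"
      unfolding N_def using fin by (simp add: sum_nonneg_eq_0_iff)
    then have "Q x = 0" unfolding Q_def by simp
    then show ?thesis using True by simp
  next
    case False
    have Npos: "N x > 0"
      using False sum_nonneg[of I "\<lambda>i. (x i)\<^sup>2"] unfolding N_def by force
    define c where "c = 1 / sqrt (N x)"
    have c2: "c * c = 1 / N x"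
      unfolding c_def using Npos by (simp add: field_simps)
    define y where "y i = (if i \<in> I then c * x i else 0)" for i
    have "N y = (c * c) * N x"
      unfolding N_def y_def by (simp add: sum_distrib_left power2_eq_square mult_ac)
    then have Ny: "N y = 1" using c2 Npos by simp
    have "y i \<in> {-1..1}" if "i \<in> I" for i
    proof -
      have "(y i)\<^sup>2 \<le> N y"
        unfolding N_def using that fin by (intro member_le_sum) auto
      then have "\<bar>y i\<bar> \<le> 1" using Ny by (simp add: abs_square_le_1)
      then show ?thesis by auto
    qed
    then have "y \<in> K"
      unfolding K_def B_def using Ny by (auto simp: y_def)
    then have "Q y \<le> \<mu>" unfolding \<mu>_def by (rule umax)
    moreover have "Q y = (c * c) * Q x"
      unfolding Q_def y_def by (simp add: sum_distrib_left mult_ac)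
    ultimately show ?thesis using c2 Npos by (simp add: field_simps)
  qed
  \<comment> \<open>\<open>\<mu> * N - Q\<close> is nonnegative and vanishes at \<open>u\<close>.
    Along the \<open>k\<close>-th unit vector \<open>d\<close> its linear coefficient is
    \<open>2 * (\<mu> * u k - g)\<close>, which must therefore be 0.\<close>
  have eig: "(\<Sum>j\<in>I. a k j * u j) = \<mu> * u k" if k: "k \<in> I" for k
  proof -
    define d where "d i = (if i = k then 1 else 0 :: real)" for i
    define g where "g = (\<Sum>j\<in>I. a k j * u j)"
    have Qud: "(\<Sum>i\<in>I. \<Sum>j\<in>I. a i j * d i * u j) = g"
    proof -
      have "(\<Sum>i\<in>I. \<Sum>j\<in>I. a i j * d i * u j) = (\<Sum>i\<in>I. d i * (\<Sum>j\<in>I. a i j * u j))"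
        by (simp add: sum_distrib_left mult_ac)
      then show ?thesis
        using k fin unfolding d_def g_def by (simp add: if_distrib[of "\<lambda>x. x * _"] cong: if_cong)
    qed
    \<comment> \<open>Symmetry of \<open>a\<close> makes the two cross terms of the expansion
      equal.\<close>
    have Qdu: "(\<Sum>i\<in>I. \<Sum>j\<in>I. a i j * u i * d j) = g"
      unfolding Qud[symmetric] by (subst sum.swap) (intro sum.cong refl, simp add: sym)
    have Q: "Q (\<lambda>i. u i + t * d i) = \<mu> + t * (2 * g) + t\<^sup>2 * Q d" for t
    proof -
      have "Q (\<lambda>i. u i + t * d i)
        = (\<Sum>i\<in>I. \<Sum>j\<in>I. a i j * u i * u j + t * (a i j * u i * d j)
            + t * (a i j * d i * u j) + t\<^sup>2 * (a i j * d i * d j))"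
        unfolding Q_def by (intro sum.cong refl) (simp add: algebra_simps power2_eq_square)
      also have "\<dots> = Q u + t * g + t * g + t\<^sup>2 * Q d"
        unfolding Q_def sum.distrib sum_distrib_left[symmetric] Qud Qdu ..
      finally show ?thesis unfolding \<mu>_def by simp
    qed
    have N: "N (\<lambda>i. u i + t * d i) = 1 + t * (2 * u k) + t\<^sup>2 * N d" for t
    proof -
      have "N (\<lambda>i. u i + t * d i)
        = (\<Sum>i\<in>I. (u i)\<^sup>2 + t * (2 * (d i * u i)) + t\<^sup>2 * (d i)\<^sup>2)"
        unfolding N_def by (intro sum.cong refl) (simp add: algebra_simps power2_eq_square)
      also have "\<dots> = N u + t * (2 * (\<Sum>i\<in>I. d i * u i)) + t\<^sup>2 * N d"
        unfolding N_def sum.distrib sum_distrib_left[symmetric] ..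
      also have "(\<Sum>i\<in>I. d i * u i) = u k"
        using k fin unfolding d_def by (simp add: if_distrib[of "\<lambda>x. x * _"] cong: if_cong)
      finally show ?thesis using Nu by simp
    qed
    have "0 \<le> t * (2 * (\<mu> * u k - g)) + t\<^sup>2 * (\<mu> * N d - Q d)" for t
      using bound[of "\<lambda>i. u i + t * d i"] unfolding Q N by (simp add: algebra_simps)
    then have "2 * (\<mu> * u k - g) = 0"
      by (rule linear_coeff_zero_if_quadratic_nonneg)
    then show ?thesis unfolding g_def by simp
  qed
  show thesis
  proof (rule that)
    show "\<exists>i\<in>I. u i \<noteq> 0" 
      using Nu unfolding N_def by (metis (mono_tags, lifting) power_zero_numeral sum.neutral zero_neq_one)
  qed (use eig bound in \<open>auto simp: Q_def N_def\<close>)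
qed

text \<open>The maximum of the Rayleigh quotient is an eigenvalue, hence at most the
  \<open>Max\<close> of the finite spectrum. For \<open>n = 0\<close> that \<open>Max\<close> is
  unspecified, but both sides are 0.\<close>

lemma rayleigh_le_largest_eigenvalue:
  fixes A :: "real mat" and x :: "nat \<Rightarrow> real"
  assumes A: "A \<in> carrier_mat n n"
    and sym: "\<And>i j. i < n \<Longrightarrow> j < n \<Longrightarrow> A $$ (i, j) = A $$ (j, i)"
  shows "(\<Sum>i<n. \<Sum>j<n. A $$ (i, j) * x i * x j) \<le> largest_eigenvalue A * (\<Sum>i<n. (x i)\<^sup>2)"
proof (cases "n = 0")
  case False
  obtain \<mu> u where nz: "\<exists>i\<in>{..<n}. u i \<noteq> 0"
    and eig: "\<And>i. i \<in> {..<n} \<Longrightarrow> (\<Sum>j<n. A $$ (i, j) * u j) = \<mu> * u i"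
    and bound: "\<And>x. (\<Sum>i<n. \<Sum>j<n. A $$ (i, j) * x i * x j) \<le> \<mu> * (\<Sum>i<n. (x i)\<^sup>2)"
  proof (rule symmetric_max_eigenvector[of "{..<n}" "\<lambda>i j. A $$ (i, j)"])
    show "{..<n} \<noteq> {}" using False by auto
  qed (use sym in auto)
  have "A *\<^sub>v vec n u = \<mu> \<cdot>\<^sub>v vec n u"
  proof (rule eq_vecI)
    fix i assume "i < dim_vec (\<mu> \<cdot>\<^sub>v vec n u)"
    then have "i < n" by simp
    then show "(A *\<^sub>v vec n u) $ i = (\<mu> \<cdot>\<^sub>v vec n u) $ i"
      using A eig[of i] by (simp add: scalar_prod_def lessThan_atLeast0)
  qed (use A in simp)
  moreover have "vec n u \<noteq> 0\<^sub>v n"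
    using nz by (metis index_vec index_zero_vec(1) lessThan_iff)
  ultimately have "\<mu> \<in> spectrum A"
    using A unfolding spectrum_def eigenvalue_def eigenvector_def
    by (intro CollectI exI[of _ "vec n u"] conjI) auto
  then have "\<mu> \<le> largest_eigenvalue A"
    unfolding largest_eigenvalue_def using card_finite_spectrum(1)[OF A] by simp
  then have "\<mu> * (\<Sum>i<n. (x i)\<^sup>2) \<le> largest_eigenvalue A * (\<Sum>i<n. (x i)\<^sup>2)"
    by (intro mult_right_mono sum_nonneg) auto
  then show ?thesis using bound[of x] by linarith
qed simp

section \<open>Quadratic forms of graphs\<close>

lemma simple_graph_finite_edges: "simple_graph V E \<Longrightarrow> finite E"
  unfolding simple_graph_def by (meson Pow_iff finite_Pow_iff finite_subset subsetI)

text \<open>Double counting: exchanging the sums counts each edge once for each of its two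
  endpoints.\<close>

lemma sum_incident_edges:
  fixes g :: "'a set \<Rightarrow> real"
  assumes G: "simple_graph V E"
  shows "(\<Sum>v\<in>V. \<Sum>e\<in>{e\<in>E. v \<in> e}. g e) = 2 * (\<Sum>e\<in>E. g e)"
proof -
  have fin: "finite V" "finite E"
    using G simple_graph_finite_edges by (auto simp: simple_graph_def)
  have "(\<Sum>v\<in>V. \<Sum>e\<in>{e\<in>E. v \<in> e}. g e) = (\<Sum>e\<in>E. \<Sum>v\<in>{v\<in>V. v \<in> e}. g e)"
    by (rule sum.swap_restrict[OF fin])
  also have "\<dots> = (\<Sum>e\<in>E. 2 * g e)"
  proof (rule sum.cong[OF refl])
    fix e assume "e \<in> E"
    then have "{v\<in>V. v \<in> e} = e" "card e = 2" using G by (auto simp: simple_graph_def)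
    then show "(\<Sum>v\<in>{v\<in>V. v \<in> e}. g e) = 2 * g e" by simp
  qed
  finally show ?thesis by (simp add: sum_distrib_left)
qed

lemma sum_vdegree:
  assumes "simple_graph V E"
  shows "(\<Sum>v\<in>V. real (vdegree E v)) = 2 * real (card E)"
  using sum_incident_edges[OF assms, of "\<lambda>_. 1"] by (simp add: vdegree_def)

text \<open>For fixed \<open>u\<close>, the map from \<open>v\<close> to \<open>{u, v}\<close> is a
  bijection from the neighbours of \<open>u\<close> to its incident edges, which reduces the claim
  to double counting.\<close>

lemma sum_adjacent_pairs:
  fixes g :: "'a set \<Rightarrow> real"
  assumes G: "simple_graph V E"
  shows "(\<Sum>u\<in>V. \<Sum>v\<in>V. if {u, v} \<in> E then g {u, v} else 0) = 2 * (\<Sum>e\<in>E. g e)"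
proof -
  have "(\<Sum>v\<in>V. if {u, v} \<in> E then g {u, v} else 0) = (\<Sum>e\<in>{e\<in>E. u \<in> e}. g e)" for u
  proof -
    have "bij_betw (\<lambda>v. {u, v}) {v\<in>V. {u, v} \<in> E} {e\<in>E. u \<in> e}"
    proof (rule bij_betw_imageI)
      show "inj_on (\<lambda>v. {u, v}) {v\<in>V. {u, v} \<in> E}"
        by (auto simp: inj_on_def doubleton_eq_iff)
      show "(\<lambda>v. {u, v}) ` {v\<in>V. {u, v} \<in> E} = {e\<in>E. u \<in> e}"
      proof (intro equalityI subsetI)
        fix e assume e: "e \<in> {e\<in>E. u \<in> e}"
        then have "card e = 2" "e \<subseteq> V" using G by (auto simp: simple_graph_def)
        then obtain v where "e = {u, v}" using e by (auto simp: card_2_iff)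
        then show "e \<in> (\<lambda>v. {u, v}) ` {v\<in>V. {u, v} \<in> E}"
          using e \<open>e \<subseteq> V\<close> by auto
      qed auto
    qed
    then have "(\<Sum>e\<in>{e\<in>E. u \<in> e}. g e) = (\<Sum>v\<in>{v\<in>V. {u, v} \<in> E}. g {u, v})"
      by (rule sum.reindex_bij_betw[symmetric])
    moreover have "finite V" using G by (simp add: simple_graph_def)
    ultimately show ?thesis by (simp add: sum.inter_filter)
  qed
  then show ?thesis using sum_incident_edges[OF G, of g] by simp
qed

text \<open>The left side is the quadratic form of the adjacency matrix at the vector with entries
  \<open>y (vs ! i)\<close>: each edge occurs there in both orders.\<close>

lemma edge_form_le_largest_eigenvalue:
  fixes y :: "'a \<Rightarrow> real"
  assumes G: "simple_graph V E" and vs: "distinct vs" "set vs = V"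
  shows "2 * (\<Sum>e\<in>E. \<Prod>v\<in>e. y v) \<le> largest_eigenvalue (adjacency_matrix vs E) * (\<Sum>v\<in>V. (y v)\<^sup>2)"
proof -
  let ?A = "adjacency_matrix vs E" and ?n = "length vs"
  have bij: "bij_betw ((!) vs) {..<?n} V"
    using vs by (intro bij_betw_nth) auto
  have "2 * (\<Sum>e\<in>E. \<Prod>v\<in>e. y v)
      = (\<Sum>u\<in>V. \<Sum>v\<in>V. if {u, v} \<in> E then \<Prod>w\<in>{u, v}. y w else 0)"
    by (rule sum_adjacent_pairs[OF G, symmetric])
  also have "\<dots> = (\<Sum>u\<in>V. \<Sum>v\<in>V. (if {u, v} \<in> E then 1 else 0) * y u * y v)"
  proof (intro sum.cong refl)
    fix u v
    \<comment> \<open>Without this the product over \<open>{u, v}\<close> could collapse to the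
      single factor \<open>y u\<close>.\<close>
    have "u \<noteq> v" if "{u, v} \<in> E" using G that by (auto simp: simple_graph_def)
    then show "(if {u, v} \<in> E then \<Prod>w\<in>{u, v}. y w else 0)
      = (if {u, v} \<in> E then 1 else 0) * y u * y v" by auto
  qed
  also have "\<dots> = (\<Sum>i<?n. \<Sum>j<?n. (if {vs ! i, vs ! j} \<in> E then 1 else 0) * y (vs ! i) * y (vs ! j))"
    by (simp only: sum.reindex_bij_betw[OF bij, symmetric])
  also have "\<dots> = (\<Sum>i<?n. \<Sum>j<?n. ?A $$ (i, j) * y (vs ! i) * y (vs ! j))"
    by (intro sum.cong refl) (auto simp: adjacency_matrix_def)
  also have "\<dots> \<le> largest_eigenvalue ?A * (\<Sum>i<?n. (y (vs ! i))\<^sup>2)"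
    by (rule rayleigh_le_largest_eigenvalue) (auto simp: adjacency_matrix_def insert_commute)
  also have "(\<Sum>i<?n. (y (vs ! i))\<^sup>2) = (\<Sum>v\<in>V. (y v)\<^sup>2)"
    by (rule sum.reindex_bij_betw[OF bij])
  finally show ?thesis .
qed

section \<open>Power sums of numbers with bounded mean\<close>

text \<open>Combines \<open>exp z \<ge> 1 + z\<close> at \<open>z = p * ln x\<close> with
  \<open>ln x \<le> x - 1\<close>, which multiplication by \<open>p \<le> 0\<close>
  reverses.\<close>

lemma powr_ge_tangent:
  fixes p x :: real
  assumes "x > 0" "p \<le> 0"
  shows "1 + p * (x - 1) \<le> x powr p"
proof -
  have "p * (x - 1) \<le> p * ln x"
    using assms ln_le_minus_one by (intro mult_left_mono_neg) auto
  also have "1 + p * ln x \<le> x powr p"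
    using assms exp_ge_add_one_self[of "p * ln x"] by (simp add: powr_def)
  finally show ?thesis by simp
qed

text \<open>Weighted AM-GM for \<open>x\<close> and 1 with weights \<open>p\<close> and
  \<open>1 - p\<close>.\<close>

lemma powr_le_tangent:
  fixes p x :: real
  assumes "x > 0" "0 \<le> p" "p \<le> 1"
  shows "x powr p \<le> 1 + p * (x - 1)"
  using Youngs_inequality_0[of p "1 - p" x 1] assms by (simp add: algebra_simps)

text \<open>After division by \<open>l\<close> the tangent at 1 applies to each term. The tangents
  sum to \<open>card S\<close> plus \<open>p\<close> times a quantity that the mean bound makes
  nonpositive, so the sign of \<open>p\<close> lets an upper bound on the mean suffice in both
  cases.\<close>

lemma sum_powr_bounded_mean:
  fixes y :: "'b \<Rightarrow> real" and l p :: real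
  assumes fin: "finite S" and pos: "\<And>i. i \<in> S \<Longrightarrow> y i > 0"
    and mean: "(\<Sum>i\<in>S. y i) \<le> l * real (card S)"
  shows "p \<le> 0 \<Longrightarrow> real (card S) * l powr p \<le> (\<Sum>i\<in>S. y i powr p)"
    and "0 \<le> p \<Longrightarrow> p \<le> 1 \<Longrightarrow> (\<Sum>i\<in>S. y i powr p) \<le> real (card S) * l powr p"
proof -
  have lpos: "l > 0" if "S \<noteq> {}"
  proof -
    have "0 < (\<Sum>i\<in>S. y i)" using fin that pos by (intro sum_pos) auto
    then have "0 < l * real (card S)" using mean by linarith
    then show ?thesis by (simp add: zero_less_mult_iff)
  qed
  show "real (card S) * l powr p \<le> (\<Sum>i\<in>S. y i powr p)" if p: "p \<le> 0"
  proof (cases "S = {}")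
    case False
    then have l: "l > 0" by (rule lpos)
    have "(\<Sum>i\<in>S. y i / l) \<le> real (card S)"
      using mean l by (simp add: sum_divide_distrib[symmetric] field_simps)
    then have "real (card S) \<le> real (card S) + p * ((\<Sum>i\<in>S. y i / l) - real (card S))"
      using p by (simp add: mult_nonpos_nonpos)
    also have "\<dots> = (\<Sum>i\<in>S. 1 + p * (y i / l - 1))"
      by (simp add: sum.distrib sum_subtractf flip: sum_distrib_left)
    also have "\<dots> \<le> (\<Sum>i\<in>S. (y i / l) powr p)"
      using pos l p by (intro sum_mono powr_ge_tangent) auto
    also have "\<dots> = (\<Sum>i\<in>S. y i powr p) / l powr p"
      unfolding sum_divide_distrib using pos l
      by (intro sum.cong refl) (simp add: powr_divide less_imp_le)
    finally show ?thesis using l by (simp add: field_simps)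
  qed simp
  show "(\<Sum>i\<in>S. y i powr p) \<le> real (card S) * l powr p" if p: "0 \<le> p" "p \<le> 1"
  proof (cases "S = {}")
    case False
    then have l: "l > 0" by (rule lpos)
    have "(\<Sum>i\<in>S. y i / l) \<le> real (card S)"
      using mean l by (simp add: sum_divide_distrib[symmetric] field_simps)
    moreover have "(\<Sum>i\<in>S. y i powr p) / l powr p = (\<Sum>i\<in>S. (y i / l) powr p)"
      unfolding sum_divide_distrib using pos l
      by (intro sum.cong refl) (simp add: powr_divide less_imp_le)
    moreover have "\<dots> \<le> (\<Sum>i\<in>S. 1 + p * (y i / l - 1))"
      using pos l p by (intro sum_mono powr_le_tangent) auto
    moreover have "\<dots> = real (card S) + p * ((\<Sum>i\<in>S. y i / l) - real (card S))"
      by (simp add: sum.distrib sum_subtractf flip: sum_distrib_left)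
    ultimately have "(\<Sum>i\<in>S. y i powr p) / l powr p \<le> real (card S)"
      using p by (smt (verit) mult_nonneg_nonpos)
    then show ?thesis using l by (simp add: field_simps)
  qed simp
qed

section \<open>The general Randic indices\<close>

theorem theorem1:
  fixes V :: "'a set" and E :: "'a set set" and vs :: "'a list"
    and n m :: nat and lam \<alpha> :: real
  assumes "simple_graph V E"
    and "no_isolated_vertices V E"
    and "n = card V"
    and "m = card E"
    and "distinct vs" and "set vs = V"
    and "lam = largest_eigenvalue (adjacency_matrix vs E)"
  shows "(\<alpha> < 0 \<longrightarrow> randic_index \<alpha> E \<ge> real m * lam powr (2 * \<alpha>)) \<and>
    (0 < \<alpha> \<and> \<alpha> \<le> 1/2 \<longrightarrow> randic_index \<alpha> E \<le> real m * lam powr (2 * \<alpha>)) \<and>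
    (\<alpha> < 0 \<longrightarrow> zeroth_randic_index \<alpha> V E \<ge> real n * lam powr \<alpha>) \<and>
    (0 < \<alpha> \<and> \<alpha> \<le> 1 \<longrightarrow> zeroth_randic_index \<alpha> V E \<le> real n * lam powr \<alpha>)"
proof -
  have G: "simple_graph V E" by fact
  have fin: "finite V" "finite E"
    using G simple_graph_finite_edges by (auto simp: simple_graph_def)
  have deg: "vdegree E v > 0" if "v \<in> V" for v
    using assms(2) that by (auto simp: no_isolated_vertices_def)
  note bound = edge_form_le_largest_eigenvalue[OF G assms(5,6), folded assms(7)]
  \<comment> \<open>At the constant vector 1 the edge form is \<open>2 * card E\<close>, which is
    the degree sum.\<close>
  have Q: "(\<Sum>v\<in>V. real (vdegree E v)) \<le> lam * real (card V)"
    using bound[of "\<lambda>_. 1"] sum_vdegree[OF G] by simp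
  let ?w = "\<lambda>e. \<Prod>v\<in>e. sqrt (real (vdegree E v))"
  \<comment> \<open>Here the squared entries of the test vector are the degrees, with sum
    \<open>2 * card E\<close>, and the factor 2 cancels.\<close>
  have R: "(\<Sum>e\<in>E. ?w e) \<le> lam * real (card E)"
    using bound[of "\<lambda>v. sqrt (real (vdegree E v))"] sum_vdegree[OF G] by simp
  have w: "?w e > 0" if "e \<in> E" for e
    using that G deg by (intro prod_pos) (auto simp: simple_graph_def subset_iff)
  have randic: "randic_index \<alpha> E = (\<Sum>e\<in>E. ?w e powr (2 * \<alpha>))"
    unfolding randic_index_def
  proof (intro sum.cong refl)
    fix e assume "e \<in> E"
    have "(\<Prod>v\<in>e. real (vdegree E v)) = ?w e ^ 2"
      by (simp add: prod_power_distrib)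
    also have "\<dots> = ?w e powr 2"
      using w[OF \<open>e \<in> E\<close>] by simp
    finally show "(\<Prod>v\<in>e. real (vdegree E v)) powr \<alpha> = ?w e powr (2 * \<alpha>)"
      by (simp add: powr_powr)
  qed
  show ?thesis
    unfolding randic zeroth_randic_index_def assms(3,4)
    using sum_powr_bounded_mean[OF fin(2) w R, of "2 * \<alpha>"]
      sum_powr_bounded_mean[OF fin(1) _ Q, of \<alpha>] deg by auto
qed

end
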